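(* Every $\sigma$-compact topological $MV$-algebra is ccc.
   Context: An $MV$-algebra is an algebra $(A,\oplus,{}^*,0)$ of type $(2,1,0)$ such that $(A,\oplus,0)$ is a commutative monoid, $x^{**}=x$, $x\oplus 0^*=0^*$ and $(x^*\oplus y)^*\oplus y=(y^*\oplus x)^*\oplus x$ for all $x,y$. A topological $MV$-algebra is an $MV$-algebra $A$ equipped with a topology such that $\oplus:A\times A\to A$ and ${}^*:A\to A$ are continuous. All spaces (in particular underlying spaces of topological $MV$-algebras) are assumed to be Tychonoff. A space is $\sigma$-compact if it is the union of countably many compact sets. A space $X$ is ccc (has the Suslin property) if every disjoint family of nonempty open subsets of $X$ is at most countable. *)

theory Defs
  imports "HOL-Analysis.Analysis"
begin

locale mv_algebra =
  fixes A :: "'a set"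
    and oplus :: "'a \<Rightarrow> 'a \<Rightarrow> 'a" (infixl \<open>\<oplus>\<close> 65)
    and neg :: "'a \<Rightarrow> 'a" (\<open>(_\<^sup>\<star>)\<close> [1000] 999)
    and zer :: 'a (\<open>\<zero>\<close>)
  assumes oplus_closed: "\<lbrakk>x \<in> A; y \<in> A\<rbrakk> \<Longrightarrow> x \<oplus> y \<in> A"
    and neg_closed: "x \<in> A \<Longrightarrow> x\<^sup>\<star> \<in> A"
    and zero_closed: "\<zero> \<in> A"
    and oplus_assoc: "\<lbrakk>x \<in> A; y \<in> A; z \<in> A\<rbrakk> \<Longrightarrow> (x \<oplus> y) \<oplus> z = x \<oplus> (y \<oplus> z)"
    and oplus_commute: "\<lbrakk>x \<in> A; y \<in> A\<rbrakk> \<Longrightarrow> x \<oplus> y = y \<oplus> x"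
    and oplus_zero: "x \<in> A \<Longrightarrow> x \<oplus> \<zero> = x"
    and neg_neg: "x \<in> A \<Longrightarrow> (x\<^sup>\<star>)\<^sup>\<star> = x"
    and oplus_neg_zero: "x \<in> A \<Longrightarrow> x \<oplus> \<zero>\<^sup>\<star> = \<zero>\<^sup>\<star>"
    and lukasiewicz: "\<lbrakk>x \<in> A; y \<in> A\<rbrakk> \<Longrightarrow> (x\<^sup>\<star> \<oplus> y)\<^sup>\<star> \<oplus> y = (y\<^sup>\<star> \<oplus> x)\<^sup>\<star> \<oplus> x"

text \<open>The separation axiom is not part of this locale; see \<open>tychonoff_space\<close> below.\<close>

locale topological_mv_algebra = mv_algebra "topspace X" oplus neg zer
  for X :: "'a topology"
    and oplus :: "'a \<Rightarrow> 'a \<Rightarrow> 'a" (infixl \<open>\<oplus>\<close> 65)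
    and neg :: "'a \<Rightarrow> 'a" (\<open>(_\<^sup>\<star>)\<close> [1000] 999)
    and zer :: 'a (\<open>\<zero>\<close>) +
  assumes continuous_oplus: "continuous_map (prod_topology X X) X (\<lambda>(x, y). x \<oplus> y)"
    and continuous_neg: "continuous_map X X neg"

text \<open>The library's \<open>completely_regular_space\<close> does not include any separation of points.\<close>

definition tychonoff_space :: "'a topology \<Rightarrow> bool"
  where "tychonoff_space X \<longleftrightarrow> completely_regular_space X \<and> t1_space X"

definition sigma_compact_space :: "'a topology \<Rightarrow> bool"
  where "sigma_compact_space X \<longleftrightarrow>
    (\<exists>\<K>. countable \<K> \<and> (\<forall>K\<in>\<K>. compactin X K) \<and> \<Union>\<K> = topspace X)"

definition ccc_space :: "'a topology \<Rightarrow> bool"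
  where "ccc_space X \<longleftrightarrow>
    (\<forall>\<U>. (\<forall>U\<in>\<U>. openin X U \<and> U \<noteq> {}) \<and> disjoint \<U> \<longrightarrow> countable \<U>)"

end

theory Submission
  imports Defs
begin

text \<open>
  An MV-algebra carries the Mal'cev term
  \<open>p x y z = ((x \<ominus> y) \<oplus> z) \<and> ((z \<ominus> y) \<oplus> x)\<close>, with \<open>p x x z = z\<close> and \<open>p x z z = x\<close>,
  so it suffices to treat \<open>\<sigma>\<close>-compact spaces with a continuous Mal'cev operation.
  If \<open>U\<^sub>i\<close> are uncountably many disjoint nonempty open sets, uncountably many of them have a point
  \<open>x\<^sub>i\<close> in a common compact set \<open>K\<close>. The pairs \<open>(a, b)\<close> with \<open>p x\<^sub>i a b \<in> U\<^sub>i\<close> and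
  \<open>p a b x\<^sub>i \<in> U\<^sub>i\<close> form an open neighbourhood \<open>E\<^sub>i\<close> of the diagonal. A closing-off argument gives
  a countable set \<open>A\<close> of indices such that for every \<open>j \<notin> A\<close> some \<open>z \<in> K\<close> in the closure of
  \<open>{x\<^sub>i | i \<in> A}\<close> cannot be told apart from \<open>x\<^sub>j\<close> by any \<open>E\<^sub>i\<close> with \<open>i \<in> A\<close>. Choosing \<open>i \<in> A\<close> with
  \<open>(x\<^sub>i, z) \<in> E\<^sub>j\<close>, the point \<open>p x\<^sub>i z x\<^sub>j\<close> lies in \<open>U\<^sub>i \<inter> U\<^sub>j\<close>.
\<close>

section \<open>Compact sets, neighbourhoods of the diagonal, and ccc from a Mal'cev
  operation\<close>

lemma regular_compactin_small_closed_cover: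
  assumes "regular_space X" "compactin X K" "openin (prod_topology X X) E"
    and diag: "\<And>x. x \<in> K \<Longrightarrow> (x, x) \<in> E"
  shows "\<exists>\<C>. finite \<C> \<and> K \<subseteq> \<Union>\<C> \<and> (\<forall>C\<in>\<C>. closedin X C \<and> C \<times> C \<subseteq> E)"
proof -
  have "\<exists>U V. openin X U \<and> closedin X V \<and> x \<in> U \<and> U \<subseteq> V \<and> V \<times> V \<subseteq> E" if xK: "x \<in> K" for x
  proof -
    obtain P Q where "openin X P" "openin X Q" "x \<in> P" "x \<in> Q" "P \<times> Q \<subseteq> E"
      using assms(3)[unfolded openin_prod_topology_alt, rule_format, OF diag[OF xK]] by meson
    moreover have "neighbourhood_base_of (closedin X) X"
      using assms(1) by (simp add: neighbourhood_base_of_closedin)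
    \<comment> \<open>Intersecting the two sides of the box makes the square of a closed
      neighbourhood fit into it.\<close>
    moreover have "openin X (P \<inter> Q)" "x \<in> P \<inter> Q"
      using calculation by auto
    ultimately obtain U V where "openin X U" "closedin X V" "x \<in> U" "U \<subseteq> V" "V \<subseteq> P \<inter> Q"
      unfolding neighbourhood_base_of by meson
    moreover have "V \<times> V \<subseteq> E"
      using \<open>V \<subseteq> P \<inter> Q\<close> \<open>P \<times> Q \<subseteq> E\<close> by (meson Int_subset_iff Sigma_mono order_trans)
    ultimately show ?thesis by blast
  qed
  then obtain U V where UV: "\<And>x. x \<in> K \<Longrightarrow> openin X (U x) \<and> closedin X (V x) \<and> x \<in> U x
      \<and> U x \<subseteq> V x \<and> V x \<times> V x \<subseteq> E"
    by metis
  have "\<forall>W\<in>U ` K. openin X W" "K \<subseteq> \<Union>(U ` K)"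
    using UV by auto
  then obtain \<F> where "finite \<F>" "\<F> \<subseteq> U ` K" "K \<subseteq> \<Union>\<F>"
    using assms(2) unfolding compactin_def by meson
  then obtain T where T: "finite T" "T \<subseteq> K" "\<F> = U ` T"
    by (meson finite_subset_image)
  show ?thesis
  proof (intro exI[of _ "V ` T"] conjI ballI)
    show "K \<subseteq> \<Union>(V ` T)"
    proof
      fix y assume "y \<in> K"
      then obtain t where "t \<in> T" "y \<in> U t"
        using \<open>K \<subseteq> \<Union>\<F>\<close> T(3) by auto
      then show "y \<in> \<Union>(V ` T)"
        using T(2) UV by (meson UN_I subsetD)
    qed
    fix W assume "W \<in> V ` T"
    then obtain t where "t \<in> K" "W = V t"
      using T(2) by auto
    then show "closedin X W" "W \<times> W \<subseteq> E"
      using UV by simp_all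
  qed (use T in simp)
qed

text \<open>A Skolem hull: the values of \<open>g\<close> are added in countably many rounds. Each
  round stays countable because a countable set has only countably many finite subsets, and the
  rounds increase, so a finite \<open>F\<close> is already covered at one of them.\<close>

lemma countable_closed_under_finitary:
  fixes C :: "'i \<Rightarrow> 'b set" and g :: "'b set \<Rightarrow> 'i"
  assumes C: "\<And>i. i \<in> I \<Longrightarrow> countable (C i)" and g: "\<And>F. g F \<in> I"
  obtains A where "countable A" "A \<subseteq> I" "\<And>F. \<lbrakk>finite F; F \<subseteq> \<Union>(C ` A)\<rbrakk> \<Longrightarrow> g F \<in> A"
proof -
  define step where "step = (\<lambda>A. A \<union> g ` {F. finite F \<and> F \<subseteq> \<Union>(C ` A)})"
  define B where "B = (\<lambda>n. (step ^^ n) {})"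
  have B_Suc: "B (Suc n) = step (B n)" for n
    by (simp add: B_def)
  have B: "countable (B n) \<and> B n \<subseteq> I" for n
  proof (induction n)
    case 0
    then show ?case by (simp add: B_def)
  next
    case (Suc n)
    then have "countable (\<Union>(C ` B n))"
      using C by (intro countable_UN) auto
    then have "countable {F. finite F \<and> F \<subseteq> \<Union>(C ` B n)}"
      by (rule countable_Collect_finite_subset)
    then show ?case
      using Suc g by (auto simp: B_Suc step_def)
  qed
  have "mono B"
    by (rule monoI, rule lift_Suc_mono_le) (auto simp: B_Suc step_def)
  have fin: "\<exists>n. F \<subseteq> \<Union>(C ` B n)" if "finite F" "F \<subseteq> \<Union>(C ` (\<Union>n. B n))" for F
    using that
  proof (induction F rule: finite_induct)
    case (insert c F)
    then obtain m n i where "F \<subseteq> \<Union>(C ` B m)" "i \<in> B n" "c \<in> C i"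
      by auto
    moreover have "B m \<subseteq> B (max m n)" "B n \<subseteq> B (max m n)"
      by (simp_all add: monoD[OF \<open>mono B\<close>])
    then have "\<Union>(C ` B m) \<subseteq> \<Union>(C ` B (max m n))" "i \<in> B (max m n)"
      using \<open>i \<in> B n\<close> by (blast, blast)
    ultimately have "insert c F \<subseteq> \<Union>(C ` B (max m n))"
      using \<open>c \<in> C i\<close> \<open>F \<subseteq> \<Union>(C ` B m)\<close> by (meson UN_I insert_subset order_trans)
    then show ?case ..
  qed simp
  show thesis
  proof
    show "countable (\<Union>n. B n)" "(\<Union>n. B n) \<subseteq> I"
      using B by auto
    fix F assume F: "finite F" "F \<subseteq> \<Union>(C ` (\<Union>n. B n))"
    then obtain n where "F \<subseteq> \<Union>(C ` B n)"
      using fin by blast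
    then have "g F \<in> B (Suc n)"
      using F by (auto simp: B_Suc step_def)
    then show "g F \<in> (\<Union>n. B n)"
      by blast
  qed
qed

lemma compactin_crossing_pair:
  assumes "regular_space X" and K: "compactin X K" and "uncountable I"
    and xK: "\<And>i. i \<in> I \<Longrightarrow> x i \<in> K"
    and E: "\<And>i. i \<in> I \<Longrightarrow> openin (prod_topology X X) (E i)"
    and diag: "\<And>i y. \<lbrakk>i \<in> I; y \<in> K\<rbrakk> \<Longrightarrow> (y, y) \<in> E i"
  shows "\<exists>i\<in>I. \<exists>j\<in>I. i \<noteq> j \<and> (\<exists>z\<in>K. (x i, z) \<in> E j \<and> (z, x j) \<in> E i)"
proof -
  \<comment> \<open>Two points in one cell of the cover are related by \<open>E i\<close>;
    closedness of the cells lets them enter the finite intersection property.\<close>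
  have "\<exists>\<C>. finite \<C> \<and> K \<subseteq> \<Union>\<C> \<and> (\<forall>C\<in>\<C>. closedin X C \<and> C \<times> C \<subseteq> E i)" if "i \<in> I" for i
    using regular_compactin_small_closed_cover[OF assms(1) K E[OF that]] diag that by blast
  then obtain \<C> where \<C>: "\<And>i. i \<in> I \<Longrightarrow> finite (\<C> i) \<and> K \<subseteq> \<Union>(\<C> i)
      \<and> (\<forall>C\<in>\<C> i. closedin X C \<and> C \<times> C \<subseteq> E i)"
    by metis
  obtain i0 where "i0 \<in> I"
    using \<open>uncountable I\<close> by (metis countable_empty equals0I)
  \<comment> \<open>\<open>g\<close> picks an index whose point lies in all the given cells; the
    default \<open>i0\<close> only keeps its values in \<open>I\<close>.\<close>
  define g where "g = (\<lambda>F. if \<exists>i\<in>I. x i \<in> \<Inter>F then SOME i. i \<in> I \<and> x i \<in> \<Inter>F else i0)"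
  have g: "g F \<in> I \<and> x (g F) \<in> \<Inter>F" if "j \<in> I" "x j \<in> \<Inter>F" for F j
  proof -
    have "(SOME i. i \<in> I \<and> x i \<in> \<Inter>F) \<in> I \<and> x (SOME i. i \<in> I \<and> x i \<in> \<Inter>F) \<in> \<Inter>F"
      by (rule someI[where x = j]) (use that in blast)
    then show ?thesis
      using that unfolding g_def by presburger
  qed
  have "g F \<in> I" for F
  proof (cases "\<exists>i\<in>I. x i \<in> \<Inter>F")
    case True
    then show ?thesis using g by blast
  next
    case False
    then show ?thesis unfolding g_def using \<open>i0 \<in> I\<close> by (simp only: if_False)
  qed
  then obtain A where A: "countable A" "A \<subseteq> I"
    and Ag: "\<And>F. \<lbrakk>finite F; F \<subseteq> \<Union>(\<C> ` A)\<rbrakk> \<Longrightarrow> g F \<in> A"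
    using countable_closed_under_finitary[of I \<C> g] \<C> by (metis countable_finite)
  obtain j where j: "j \<in> I" "j \<notin> A"
    using A \<open>uncountable I\<close> by (meson countable_subset subsetI)
  have "\<exists>C\<in>\<C> i. x j \<in> C" if "i \<in> A" for i
    using \<C>[of i] xK[OF j(1)] A that by blast
  \<comment> \<open>\<open>V i\<close> is a cell of the \<open>i\<close>-th cover that contains
    \<open>x j\<close>; a \<open>z\<close> in all of these is \<open>E i\<close>-related to
    \<open>x j\<close> for every \<open>i\<close> in \<open>A\<close> at once.\<close>
  then obtain V where V: "\<And>i. i \<in> A \<Longrightarrow> V i \<in> \<C> i \<and> x j \<in> V i"
    by metis
  define S where "S = X closure_of (x ` A)"
  have xtop: "x ` A \<subseteq> topspace X"
    using xK A compactin_subset_topspace[OF K] by blast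
  have "K \<inter> \<Inter>\<F> \<noteq> {}" if "finite \<F>" "\<F> \<subseteq> insert S (V ` A)" for \<F>
  proof -
    have "x j \<in> \<Inter>(\<F> - {S})"
      using that V by blast
    moreover have "g (\<F> - {S}) \<in> A"
      using that V by (intro Ag) auto
    moreover have "x ` A \<subseteq> S"
      unfolding S_def by (rule closure_of_subset[OF xtop])
    ultimately have "x (g (\<F> - {S})) \<in> K \<inter> \<Inter>(\<F> - {S}) \<inter> S"
      using g[OF j(1)] xK by (meson IntI image_subset_iff)
    then show ?thesis by blast
  qed
  moreover have "\<forall>C\<in>insert S (V ` A). closedin X C"
    using V \<C> A unfolding S_def by (metis closedin_closure_of image_iff insertE subsetD)
  ultimately have "K \<inter> \<Inter>(insert S (V ` A)) \<noteq> {}"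
    using K unfolding compactin_fip by presburger
  then obtain z where z: "z \<in> K" "z \<in> S" "\<And>i. i \<in> A \<Longrightarrow> z \<in> V i"
    by blast
  obtain P Q where PQ: "openin X P" "z \<in> P" "z \<in> Q" "P \<times> Q \<subseteq> E j"
    using E[OF j(1), unfolded openin_prod_topology_alt, rule_format, OF diag[OF j(1) z(1)]] by meson
  then obtain i where i: "i \<in> A" "x i \<in> P"
    using z(2) unfolding S_def in_closure_of by blast
  have "(x i, z) \<in> E j"
    using PQ i by blast
  moreover have "(z, x j) \<in> E i"
    using V[OF i(1)] \<C> z(3)[OF i(1)] A i(1) by blast
  moreover have "i \<in> I" "i \<noteq> j"
    using i(1) A(2) j(2) by auto
  ultimately show ?thesis
    using j(1) z(1) by meson
qed

theorem maltsev_sigma_compact_imp_ccc: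
  assumes "regular_space X" "sigma_compact_space X"
    and cont: "continuous_map (prod_topology X (prod_topology X X)) X (\<lambda>(x, y, z). p x y z)"
    and pl: "\<And>x z. \<lbrakk>x \<in> topspace X; z \<in> topspace X\<rbrakk> \<Longrightarrow> p x x z = z"
    and pr: "\<And>x z. \<lbrakk>x \<in> topspace X; z \<in> topspace X\<rbrakk> \<Longrightarrow> p x z z = x"
  shows "ccc_space X"
  unfolding ccc_space_def
proof (intro allI impI, rule ccontr)
  fix \<U> assume \<U>: "(\<forall>U\<in>\<U>. openin X U \<and> U \<noteq> {}) \<and> disjoint \<U>" and unc: "uncountable \<U>"
  obtain \<K> where \<K>: "countable \<K>" "\<And>K. K \<in> \<K> \<Longrightarrow> compactin X K" "\<Union>\<K> = topspace X"
    using assms(2) unfolding sigma_compact_space_def by meson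
  \<comment> \<open>Countably many compact sets cover the space, so one of them meets uncountably
    many members of \<open>\<U>\<close>.\<close>
  have "\<U> \<subseteq> (\<Union>K\<in>\<K>. {U \<in> \<U>. U \<inter> K \<noteq> {}})"
  proof
    fix U assume "U \<in> \<U>"
    then have "U \<subseteq> topspace X" "U \<noteq> {}"
      using \<U> openin_subset by auto
    then obtain y where "y \<in> U" "y \<in> topspace X"
      by blast
    then show "U \<in> (\<Union>K\<in>\<K>. {U \<in> \<U>. U \<inter> K \<noteq> {}})"
      using \<K>(3) \<open>U \<in> \<U>\<close> by blast
  qed
  then obtain K where K: "K \<in> \<K>" and "uncountable {U \<in> \<U>. U \<inter> K \<noteq> {}}" (is "uncountable ?I")
    using unc \<K>(1) by (meson countable_UN countable_subset)
  have Ktop: "K \<subseteq> topspace X"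
    using K \<K>(3) by blast
  have "\<exists>y. y \<in> U \<inter> K" if "U \<in> ?I" for U
    using that by blast
  then obtain x where x: "\<And>U. U \<in> ?I \<Longrightarrow> x U \<in> U \<inter> K"
    by metis
  \<comment> \<open>Both placements of \<open>x U\<close> are needed: in the crossing pair,
    \<open>U\<close> uses its point as first argument of \<open>p\<close> and \<open>W\<close> as
    third.\<close>
  define E where "E U = {w \<in> topspace (prod_topology X X). p (x U) (fst w) (snd w) \<in> U}
    \<inter> {w \<in> topspace (prod_topology X X). p (fst w) (snd w) (x U) \<in> U}" for U
  have "openin (prod_topology X X) (E U)" if "U \<in> ?I" for U
  proof -
    have xU: "x U \<in> topspace X" and U: "openin X U"
      using x[OF that] Ktop \<U> that by auto
    have "continuous_map (prod_topology X X) (prod_topology X (prod_topology X X)) (\<lambda>w. (x U, fst w, snd w))"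
      using xU by (simp add: continuous_map_pairwise o_def continuous_map_fst continuous_map_snd)
    from continuous_map_compose[OF this cont]
    have "continuous_map (prod_topology X X) X (\<lambda>w. p (x U) (fst w) (snd w))"
      by (simp add: o_def case_prod_unfold)
    moreover have "continuous_map (prod_topology X X) (prod_topology X (prod_topology X X)) (\<lambda>w. (fst w, snd w, x U))"
      using xU by (simp add: continuous_map_pairwise o_def continuous_map_fst continuous_map_snd)
    from continuous_map_compose[OF this cont]
    have "continuous_map (prod_topology X X) X (\<lambda>w. p (fst w) (snd w) (x U))"
      by (simp add: o_def case_prod_unfold)
    ultimately show ?thesis
      unfolding E_def using U by (intro openin_Int openin_continuous_map_preimage)
  qed
  moreover have "(y, y) \<in> E U" if "U \<in> ?I" "y \<in> K" for U y
  proof -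
    have "y \<in> topspace X" "x U \<in> topspace X" "x U \<in> U"
      using that x[OF that(1)] Ktop by auto
    then show ?thesis by (simp add: E_def pl pr)
  qed
  ultimately have "\<exists>U\<in>?I. \<exists>W\<in>?I. U \<noteq> W \<and> (\<exists>z\<in>K. (x U, z) \<in> E W \<and> (z, x W) \<in> E U)"
    using x by (intro compactin_crossing_pair[OF assms(1) \<K>(2)[OF K] \<open>uncountable ?I\<close>]) simp_all
  then obtain U W z where UW: "U \<in> ?I" "W \<in> ?I" "U \<noteq> W" "(x U, z) \<in> E W" "(z, x W) \<in> E U"
    by meson
  then have "p (x U) z (x W) \<in> U \<inter> W"
    by (simp add: E_def)
  moreover have "U \<inter> W = {}"
    using UW \<U> by (simp add: disjoint_def)
  ultimately show False by blast
qed

section \<open>The Mal'cev term of an MV-algebra\<close>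

context mv_algebra
begin

text \<open>Truncated subtraction: on the unit interval it is max(x - y, 0), and
  \<open>diff x y \<oplus> y\<close> is the lattice join.\<close>

definition diff :: "'a \<Rightarrow> 'a \<Rightarrow> 'a"
  where "diff x y = (x\<^sup>\<star> \<oplus> y)\<^sup>\<star>"

text \<open>The De Morgan dual of the join \<open>diff x y \<oplus> y\<close>.\<close>

definition meet :: "'a \<Rightarrow> 'a \<Rightarrow> 'a"
  where "meet x y = (diff (x\<^sup>\<star>) (y\<^sup>\<star>) \<oplus> y\<^sup>\<star>)\<^sup>\<star>"

definition maltsev :: "'a \<Rightarrow> 'a \<Rightarrow> 'a \<Rightarrow> 'a"
  where "maltsev x y z = meet (diff x y \<oplus> z) (diff z y \<oplus> x)"

lemma zero_oplus: "x \<in> A \<Longrightarrow> \<zero> \<oplus> x = x"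
  using oplus_commute oplus_zero zero_closed by metis

lemma diff_closed: "\<lbrakk>x \<in> A; y \<in> A\<rbrakk> \<Longrightarrow> diff x y \<in> A"
  by (simp add: diff_def oplus_closed neg_closed)

text \<open>This is the Lukasiewicz axiom with the top element \<open>\<zero>\<^sup>\<star>\<close>
  in place of \<open>y\<close>.\<close>

lemma neg_oplus_self:
  assumes "x \<in> A" shows "x\<^sup>\<star> \<oplus> x = \<zero>\<^sup>\<star>"
proof -
  have "(x\<^sup>\<star> \<oplus> \<zero>\<^sup>\<star>)\<^sup>\<star> \<oplus> \<zero>\<^sup>\<star> = ((\<zero>\<^sup>\<star>)\<^sup>\<star> \<oplus> x)\<^sup>\<star> \<oplus> x"
    using assms by (intro lukasiewicz neg_closed zero_closed)
  then show ?thesis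
    using assms by (simp add: oplus_neg_zero neg_closed neg_neg zero_closed zero_oplus)
qed

lemma diff_self: "x \<in> A \<Longrightarrow> diff x x = \<zero>"
  by (simp add: diff_def neg_oplus_self neg_neg zero_closed)

lemma diff_oplus_commute: "\<lbrakk>x \<in> A; y \<in> A\<rbrakk> \<Longrightarrow> diff x y \<oplus> y = diff y x \<oplus> x"
  by (simp add: diff_def lukasiewicz)

lemma meet_commute: "\<lbrakk>x \<in> A; y \<in> A\<rbrakk> \<Longrightarrow> meet x y = meet y x"
  by (simp add: meet_def diff_oplus_commute neg_closed)

text \<open>Lattice absorption: adding \<open>y\<^sup>\<star>\<close> to the join gives the top
  element, so the difference of the complements inside \<open>meet\<close> vanishes.\<close>

lemma meet_absorb:
  assumes "x \<in> A" "y \<in> A" shows "meet (diff x y \<oplus> y) y = y"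
proof -
  have "(diff x y \<oplus> y) \<oplus> y\<^sup>\<star> = diff x y \<oplus> \<zero>\<^sup>\<star>"
    using assms by (metis diff_closed neg_closed neg_oplus_self oplus_assoc oplus_commute)
  also have "\<dots> = \<zero>\<^sup>\<star>"
    using assms by (simp add: diff_closed oplus_neg_zero)
  finally have "diff ((diff x y \<oplus> y)\<^sup>\<star>) (y\<^sup>\<star>) = \<zero>"
    using assms by (simp add: diff_def[of "(diff x y \<oplus> y)\<^sup>\<star>"] neg_neg zero_closed oplus_closed diff_closed)
  then show ?thesis
    using assms by (simp add: meet_def zero_oplus neg_neg neg_closed)
qed

text \<open>One argument of the meet collapses to \<open>z\<close>, the other becomes the join of
  \<open>x\<close> and \<open>z\<close>, so absorption applies.\<close>

lemma maltsev_left: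
  assumes "x \<in> A" "z \<in> A" shows "maltsev x x z = z"
proof -
  have "maltsev x x z = meet z (diff x z \<oplus> z)"
    using assms by (simp add: maltsev_def diff_self zero_oplus diff_oplus_commute[of x z])
  also have "\<dots> = meet (diff x z \<oplus> z) z"
    using assms by (intro meet_commute oplus_closed diff_closed)
  finally show ?thesis
    using assms by (simp add: meet_absorb)
qed

lemma maltsev_right:
  assumes "x \<in> A" "z \<in> A" shows "maltsev x z z = x"
proof -
  have "maltsev x z z = meet (diff z x \<oplus> x) x"
    using assms by (simp only: maltsev_def diff_self zero_oplus diff_oplus_commute[of x z])
  then show ?thesis
    using assms by (simp add: meet_absorb)
qed

end

section \<open>Continuity of the Mal'cev term\<close>

context topological_mv_algebra
begin

lemma continuous_map_oplus:
  assumes "continuous_map Y X f" "continuous_map Y X g"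
  shows "continuous_map Y X (\<lambda>w. f w \<oplus> g w)"
  using continuous_map_compose[OF _ continuous_oplus, of Y "\<lambda>w. (f w, g w)"] assms
  by (simp add: continuous_map_pairwise o_def)

lemma continuous_map_neg: "continuous_map Y X f \<Longrightarrow> continuous_map Y X (\<lambda>w. (f w)\<^sup>\<star>)"
  using continuous_map_compose[OF _ continuous_neg, of Y f] by (simp add: o_def)

lemma continuous_map_maltsev:
  "continuous_map (prod_topology X (prod_topology X X)) X (\<lambda>(x, y, z). maltsev x y z)"
proof -
  let ?Y = "prod_topology X (prod_topology X X)"
  have "continuous_map ?Y X (\<lambda>w. fst w)" "continuous_map ?Y X (\<lambda>w. fst (snd w))"
    "continuous_map ?Y X (\<lambda>w. snd (snd w))"
    by (intro continuous_map_fst continuous_map_fst_of[OF continuous_map_snd, unfolded o_def]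
        continuous_map_snd_of[OF continuous_map_snd, unfolded o_def])+
  then show ?thesis
    unfolding case_prod_unfold maltsev_def meet_def diff_def
    by (intro continuous_map_oplus continuous_map_neg)
qed

end

theorem theorem3p6:
  fixes X :: "'a topology"
    and oplus :: "'a \<Rightarrow> 'a \<Rightarrow> 'a"
    and neg :: "'a \<Rightarrow> 'a"
    and zer :: 'a
  assumes "topological_mv_algebra X oplus neg zer"
    and "tychonoff_space X"
    and "sigma_compact_space X"
  shows "ccc_space X"
proof -
  interpret topological_mv_algebra X oplus neg zer by fact
  have "regular_space X"
    using assms(2) completely_regular_imp_regular_space unfolding tychonoff_space_def by blast
  then show ?thesis
    using assms(3) continuous_map_maltsev maltsev_left maltsev_right
    by (rule maltsev_sigma_compact_imp_ccc)
qed

end
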